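(* (a) $\mathsf{EL}_{K,\Box,B}+(\mathrm{CB})$ is a sound and complete axiomatization of $\mathcal{L}_{K,\Box,B}$ with respect to the class of all topological subset spaces under the "almost-everywhere" e-d semantics $|\!\approx$: for every $\varphi\in\mathcal{L}_{K,\Box,B}$, $\varphi$ is provable in $\mathsf{EL}_{K,\Box,B}+(\mathrm{CB})$ if and only if $(\mathcal{X},x,U,V)\,|\!\approx\varphi$ for every topological subset model $\mathcal{X}$ and every e-d scenario $(x,U,V)$ of $\mathcal{X}$. (b) Moreover, $\mathsf{SEL}_{K,\Box,B}$ is sound and complete with respect to these semantics for e-d scenarios with $V=U$: for every $\varphi\in\mathcal{L}_{K,\Box,B}$, $\varphi$ is provable in $\mathsf{SEL}_{K,\Box,B}$ if and only if $(\mathcal{X},x,U,U)\,|\!\approx\varphi$ for every topological subset model $\mathcal{X}=(X,\mathcal{T},v)$ and all $x\in U\in\mathcal{T}$.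
   Context: Language. Fix a countable set PROP of primitive propositions. $\mathcal{L}_{K,\Box,B}$ is generated by $\varphi ::= p \mid \neg\varphi \mid \varphi\wedge\psi \mid K\varphi\mid\Box\varphi\mid B\varphi$, $p\in$ PROP. The connectives $\vee,\to,\leftrightarrow$ are defined as usual and $\Diamond:=\neg\Box\neg$. The logic $\mathsf{EL}_{K,\Box,B}$ is the Hilbert system (schemes and rules ranging over formulas of $\mathcal{L}_{K,\Box,B}$) consisting of classical propositional logic (with modus ponens) plus: the $\mathsf{S5}$ principles for $K$: $K(\varphi\to\psi)\to(K\varphi\to K\psi)$, $K\varphi\to\varphi$, $K\varphi\to KK\varphi$, $\neg K\varphi\to K\neg K\varphi$, and the rule "from $\vdash\varphi$ infer $\vdash K\varphi$"; the $\mathsf{S4}$ principles for $\Box$: $\Box(\varphi\to\psi)\to(\Box\varphi\to\Box\psi)$, $\Box\varphi\to\varphi$, $\Box\varphi\to\Box\Box\varphi$, and the rule "from $\vdash\varphi$ infer $\vdash\Box\varphi$"; the schemes $(\mathrm{KI})$ $K\varphi\to\Box\varphi$; $(\mathrm{K}_B)$ $B(\varphi\to\psi)\to(B\varphi\to B\psi)$; $(\mathrm{sPI})$ $B\varphi\to KB\varphi$; $(\mathrm{KB})$ $K\varphi\to B\varphi$; $(\mathrm{RB})$ $B\varphi\to B\Box\varphi$. Additional schemes: $(\mathrm{wF})$ $B\varphi\to\Diamond\varphi$; $(\mathrm{CB})$ $B(\Box\varphi\vee\Box\neg\Box\varphi)$. $\mathsf{EL}_{K,\Box,B}+(\mathrm{CB})$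 is obtained by adding $(\mathrm{CB})$, and $\mathsf{SEL}_{K,\Box,B}$ is obtained from $\mathsf{EL}_{K,\Box,B}$ by adding both $(\mathrm{wF})$ and $(\mathrm{CB})$. Semantics. A topological subset model is a triple $\mathcal{X}=(X,\mathcal{T},v)$ where $X$ is a nonempty set, $\mathcal{T}$ is a topology on $X$, and $v:\mathrm{PROP}\to 2^X$. An e-d scenario of $\mathcal{X}$ is a tuple $(x,U,V)$ with $x\in U$, $U,V\in\mathcal{T}$ and $V\subseteq U$ (neither $x\in V$ nor $V\neq\emptyset$ is required). A set $S\subseteq X$ is nowhere dense if $\mathit{int}(\mathit{cl}(S))=\emptyset$, with $\mathit{int}$, $\mathit{cl}$ the interior and closure in $(X,\mathcal{T})$; for $A,C\subseteq X$ write $A\subseteq^{*}C$ iff $A\setminus C$ is nowhere dense. Let $(\!|\varphi|\!)^{U,V}=\{y\in U : (\mathcal{X},y,U,V)\,|\!\approx\varphi\}$. The relation $|\!\approx$ is defined by: $(\mathcal{X},x,U,V)\,|\!\approx p$ iff $x\in v(p)$; the usual clauses for $\neg$ and $\wedge$; $(\mathcal{X},x,U,V)\,|\!\approx K\varphi$ iff $U=(\!|\varphi|\!)^{U,V}$; $(\mathcal{X},x,U,V)\,|\!\approx\Box\varphi$ iff $x\in\mathit{int}((\!|\varphi|\!)^{U,V})$; $(\mathcal{X},x,U,V)\,|\!\approx B\varphi$ iff $V\subseteq^{*}(\!|\varphi|\!)^{U,V}$. *)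

theory Defs
  imports "HOL-Analysis.Analysis"
begin

section \<open>Language\<close>

datatype 'p fm =
    Atom 'p
  | Neg "'p fm"            ("\<^bold>\<not> _" [75] 75)
  | And "'p fm" "'p fm"    (infixr "\<^bold>\<and>" 70)
  | Know "'p fm"           ("\<^bold>K _" [75] 75)
  | Box "'p fm"            ("\<^bold>\<box> _" [75] 75)
  | Bel "'p fm"            ("\<^bold>B _" [75] 75)

abbreviation Or :: "'p fm \<Rightarrow> 'p fm \<Rightarrow> 'p fm"  (infixr "\<^bold>\<or>" 65)
  where "\<phi> \<^bold>\<or> \<psi> \<equiv> \<^bold>\<not> (\<^bold>\<not> \<phi> \<^bold>\<and> \<^bold>\<not> \<psi>)"

abbreviation Imp :: "'p fm \<Rightarrow> 'p fm \<Rightarrow> 'p fm"  (infixr "\<^bold>\<longrightarrow>" 60)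
  where "\<phi> \<^bold>\<longrightarrow> \<psi> \<equiv> \<^bold>\<not> (\<phi> \<^bold>\<and> \<^bold>\<not> \<psi>)"

abbreviation Dia :: "'p fm \<Rightarrow> 'p fm"  ("\<^bold>\<diamond> _" [75] 75)
  where "\<^bold>\<diamond> \<phi> \<equiv> \<^bold>\<not> (\<^bold>\<box> (\<^bold>\<not> \<phi>))"


section \<open>Proof systems\<close>

text \<open>Classical propositional logic enters through all substitution instances of tautologies:
  a propositional valuation \<open>h\<close> treats atoms and modal formulas as propositional letters.\<close>

fun prop_eval :: "('p fm \<Rightarrow> bool) \<Rightarrow> 'p fm \<Rightarrow> bool" where
  "prop_eval h (\<^bold>\<not> \<phi>) \<longleftrightarrow> \<not> prop_eval h \<phi>"
| "prop_eval h (\<phi> \<^bold>\<and> \<psi>) \<longleftrightarrow> prop_eval h \<phi> \<and> prop_eval h \<psi>"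
| "prop_eval h (Atom p) \<longleftrightarrow> h (Atom p)"
| "prop_eval h (\<^bold>K \<phi>) \<longleftrightarrow> h (\<^bold>K \<phi>)"
| "prop_eval h (\<^bold>\<box> \<phi>) \<longleftrightarrow> h (\<^bold>\<box> \<phi>)"
| "prop_eval h (\<^bold>B \<phi>) \<longleftrightarrow> h (\<^bold>B \<phi>)"

definition tautology :: "'p fm \<Rightarrow> bool" where
  "tautology \<phi> \<longleftrightarrow> (\<forall>h. prop_eval h \<phi>)"

text \<open>The system \<open>EL\<close> extended by the formulas in \<open>A\<close> as further axioms.\<close>

inductive EL_plus :: "'p fm set \<Rightarrow> 'p fm \<Rightarrow> bool" for A :: "'p fm set" where
  Taut: "tautology \<phi> \<Longrightarrow> EL_plus A \<phi>"
| MP: "EL_plus A (\<phi> \<^bold>\<longrightarrow> \<psi>) \<Longrightarrow> EL_plus A \<phi> \<Longrightarrow> EL_plus A \<psi>"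
| K_K: "EL_plus A (\<^bold>K (\<phi> \<^bold>\<longrightarrow> \<psi>) \<^bold>\<longrightarrow> (\<^bold>K \<phi> \<^bold>\<longrightarrow> \<^bold>K \<psi>))"
| T_K: "EL_plus A (\<^bold>K \<phi> \<^bold>\<longrightarrow> \<phi>)"
| Four_K: "EL_plus A (\<^bold>K \<phi> \<^bold>\<longrightarrow> \<^bold>K (\<^bold>K \<phi>))"
| Five_K: "EL_plus A (\<^bold>\<not> (\<^bold>K \<phi>) \<^bold>\<longrightarrow> \<^bold>K (\<^bold>\<not> (\<^bold>K \<phi>)))"
| Nec_K: "EL_plus A \<phi> \<Longrightarrow> EL_plus A (\<^bold>K \<phi>)"
| K_Box: "EL_plus A (\<^bold>\<box> (\<phi> \<^bold>\<longrightarrow> \<psi>) \<^bold>\<longrightarrow> (\<^bold>\<box> \<phi> \<^bold>\<longrightarrow> \<^bold>\<box> \<psi>))"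
| T_Box: "EL_plus A (\<^bold>\<box> \<phi> \<^bold>\<longrightarrow> \<phi>)"
| Four_Box: "EL_plus A (\<^bold>\<box> \<phi> \<^bold>\<longrightarrow> \<^bold>\<box> (\<^bold>\<box> \<phi>))"
| Nec_Box: "EL_plus A \<phi> \<Longrightarrow> EL_plus A (\<^bold>\<box> \<phi>)"
| KI: "EL_plus A (\<^bold>K \<phi> \<^bold>\<longrightarrow> \<^bold>\<box> \<phi>)"
| K_B: "EL_plus A (\<^bold>B (\<phi> \<^bold>\<longrightarrow> \<psi>) \<^bold>\<longrightarrow> (\<^bold>B \<phi> \<^bold>\<longrightarrow> \<^bold>B \<psi>))"
| sPI: "EL_plus A (\<^bold>B \<phi> \<^bold>\<longrightarrow> \<^bold>K (\<^bold>B \<phi>))"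
| KB: "EL_plus A (\<^bold>K \<phi> \<^bold>\<longrightarrow> \<^bold>B \<phi>)"
| RB: "EL_plus A (\<^bold>B \<phi> \<^bold>\<longrightarrow> \<^bold>B (\<^bold>\<box> \<phi>))"
| Extra: "\<phi> \<in> A \<Longrightarrow> EL_plus A \<phi>"

definition wF :: "'p fm set" where
  "wF = {\<^bold>B \<phi> \<^bold>\<longrightarrow> \<^bold>\<diamond> \<phi> | \<phi>. True}"

definition CB :: "'p fm set" where
  "CB = {\<^bold>B (\<^bold>\<box> \<phi> \<^bold>\<or> \<^bold>\<box> (\<^bold>\<not> (\<^bold>\<box> \<phi>))) | \<phi>. True}"

definition EL_CB :: "'p fm \<Rightarrow> bool" where
  "EL_CB = EL_plus CB"

definition SEL :: "'p fm \<Rightarrow> bool" where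
  "SEL = EL_plus (wF \<union> CB)"


section \<open>Almost-everywhere e-d semantics\<close>

definition nowhere_dense_in :: "'a topology \<Rightarrow> 'a set \<Rightarrow> bool" where
  "nowhere_dense_in T S \<longleftrightarrow> S \<subseteq> topspace T \<and> T interior_of (T closure_of S) = {}"

definition almost_subset :: "'a topology \<Rightarrow> 'a set \<Rightarrow> 'a set \<Rightarrow> bool" where
  "almost_subset T A C \<longleftrightarrow> nowhere_dense_in T (A - C)"

text \<open>A model is a topology \<open>T\<close> on its carrier \<open>topspace T\<close> with a valuation \<open>v\<close>.\<close>

definition top_subset_model :: "'a topology \<Rightarrow> ('p \<Rightarrow> 'a set) \<Rightarrow> bool" where
  "top_subset_model T v \<longleftrightarrow> topspace T \<noteq> {} \<and> (\<forall>p. v p \<subseteq> topspace T)"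

definition ed_scenario :: "'a topology \<Rightarrow> 'a \<Rightarrow> 'a set \<Rightarrow> 'a set \<Rightarrow> bool" where
  "ed_scenario T x U V \<longleftrightarrow> openin T U \<and> openin T V \<and> x \<in> U \<and> V \<subseteq> U"

fun sat :: "'a topology \<Rightarrow> ('p \<Rightarrow> 'a set) \<Rightarrow> 'a \<Rightarrow> 'a set \<Rightarrow> 'a set \<Rightarrow> 'p fm \<Rightarrow> bool" where
  "sat T v x U V (Atom p) \<longleftrightarrow> x \<in> v p"
| "sat T v x U V (\<^bold>\<not> \<phi>) \<longleftrightarrow> \<not> sat T v x U V \<phi>"
| "sat T v x U V (\<phi> \<^bold>\<and> \<psi>) \<longleftrightarrow> sat T v x U V \<phi> \<and> sat T v x U V \<psi>"
| "sat T v x U V (\<^bold>K \<phi>) \<longleftrightarrow> U = {y \<in> U. sat T v y U V \<phi>}"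
| "sat T v x U V (\<^bold>\<box> \<phi>) \<longleftrightarrow> x \<in> T interior_of {y \<in> U. sat T v y U V \<phi>}"
| "sat T v x U V (\<^bold>B \<phi>) \<longleftrightarrow> almost_subset T V {y \<in> U. sat T v y U V \<phi>}"

text \<open>Validity in all models whose points are drawn from the type \<open>'a\<close>, over all e-d scenarios
  and over those with \<open>V = U\<close> respectively.\<close>

definition ae_valid :: "'a itself \<Rightarrow> 'p fm \<Rightarrow> bool" where
  "ae_valid _ \<phi> \<longleftrightarrow>
     (\<forall>(T :: 'a topology) v x U V.
        top_subset_model T v \<longrightarrow> ed_scenario T x U V \<longrightarrow> sat T v x U V \<phi>)"

definition ae_valid_diag :: "'a itself \<Rightarrow> 'p fm \<Rightarrow> bool" where
  "ae_valid_diag _ \<phi> \<longleftrightarrow>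
     (\<forall>(T :: 'a topology) v x U.
        top_subset_model T v \<longrightarrow> ed_scenario T x U U \<longrightarrow> sat T v x U U \<phi>)"

end

theory Submission
  imports Defs
begin

text \<open>Soundness is a computation with interiors; \<open>CB\<close> holds because the boundary of an open set is
  nowhere dense. For completeness, let \<open>\<Gamma>\<close> be a maximal consistent set refuting \<open>\<phi>\<close>, let \<open>U\<close> be its
  \<open>K\<close>-cluster with the Alexandroff topology of the \<open>\<box>\<close>-accessibility preorder, and let \<open>W\<close> be the
  set of points containing all formulas believed at \<open>\<Gamma>\<close>. \<open>RB\<close> makes \<open>W\<close> open, and \<open>CB\<close> makes
  accessibility symmetric on \<open>W\<close>, so that a subset of \<open>W\<close> is nowhere dense only if it is empty.
  Hence \<open>V = W\<close> works for \<open>EL\<close> with \<open>CB\<close>. Under \<open>wF\<close> the set \<open>W\<close> is moreover dense in \<open>U\<close>, so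
  that \<open>V = U\<close> validates the same beliefs.\<close>

section \<open>Nowhere dense sets\<close>

text \<open>Turns most later arguments into shrinking of open sets, without closures. The witness
  for the refinement is \<open>P\<close> minus the closure of \<open>S\<close>, which is nonempty
  because the closure has no interior.\<close>

lemma nowhere_dense_in_iff:
  "nowhere_dense_in T S \<longleftrightarrow> S \<subseteq> topspace T \<and>
     (\<forall>P. openin T P \<longrightarrow> P \<noteq> {} \<longrightarrow> (\<exists>Q. openin T Q \<and> Q \<noteq> {} \<and> Q \<subseteq> P \<and> Q \<inter> S = {}))"
  (is "_ \<longleftrightarrow> _ \<and> ?R")
proof -
  have "T interior_of (T closure_of S) = {} \<longleftrightarrow> ?R" if S: "S \<subseteq> topspace T"
  proof
    assume e: "T interior_of (T closure_of S) = {}"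
    show ?R
    proof (intro allI impI)
      fix P assume P: "openin T P" "P \<noteq> {}"
      have "\<not> P \<subseteq> T closure_of S"
        using P e interior_of_maximal by blast
      moreover have "openin T (P - T closure_of S)"
        using P by (simp add: openin_diff)
      moreover have "(P - T closure_of S) \<inter> S = {}"
        using closure_of_subset[OF S] by blast
      ultimately show "\<exists>Q. openin T Q \<and> Q \<noteq> {} \<and> Q \<subseteq> P \<and> Q \<inter> S = {}"
        by (intro exI[of _ "P - T closure_of S"]) blast
    qed
  next
    assume R: ?R
    show "T interior_of (T closure_of S) = {}"
    proof (rule ccontr)
      assume "T interior_of (T closure_of S) \<noteq> {}"
      then obtain Q where Q: "openin T Q" "Q \<noteq> {}" "Q \<subseteq> T interior_of (T closure_of S)" "Q \<inter> S = {}"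
        using R by (meson openin_interior_of)
      have "Q \<subseteq> T closure_of S"
        using Q(3) interior_of_subset[of T "T closure_of S"] by (rule subset_trans)
      then obtain y where "y \<in> Q" "y \<in> T closure_of S"
        using Q(2) by blast
      then show False
        using Q(1,4) by (auto simp: in_closure_of)
    qed
  qed
  then show ?thesis
    by (auto simp: nowhere_dense_in_def)
qed

lemma nowhere_dense_in_empty: "nowhere_dense_in T {}"
  by (auto simp: nowhere_dense_in_def)

lemma nowhere_dense_in_subset:
  assumes "nowhere_dense_in T S" "S' \<subseteq> S"
  shows "nowhere_dense_in T S'"
  unfolding nowhere_dense_in_iff
proof (intro conjI allI impI)
  show "S' \<subseteq> topspace T"
    using assms by (auto simp: nowhere_dense_in_def)
  fix P assume "openin T P" "P \<noteq> {}"
  then obtain Q where "openin T Q" "Q \<noteq> {}" "Q \<subseteq> P" "Q \<inter> S = {}"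
    using assms(1) unfolding nowhere_dense_in_iff by meson
  then show "\<exists>Q. openin T Q \<and> Q \<noteq> {} \<and> Q \<subseteq> P \<and> Q \<inter> S' = {}"
    using assms(2) by blast
qed

text \<open>Shrink \<open>P\<close> twice, once for each set. This is what makes belief closed under
  \<open>K_B\<close>.\<close>

lemma nowhere_dense_in_Un:
  assumes "nowhere_dense_in T S" "nowhere_dense_in T S'"
  shows "nowhere_dense_in T (S \<union> S')"
  unfolding nowhere_dense_in_iff
proof (intro conjI allI impI)
  show "S \<union> S' \<subseteq> topspace T"
    using assms by (auto simp: nowhere_dense_in_def)
  fix P assume "openin T P" "P \<noteq> {}"
  then obtain Q where Q: "openin T Q" "Q \<noteq> {}" "Q \<subseteq> P" "Q \<inter> S = {}"
    using assms(1) unfolding nowhere_dense_in_iff by meson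
  then obtain Q' where "openin T Q'" "Q' \<noteq> {}" "Q' \<subseteq> Q" "Q' \<inter> S' = {}"
    using assms(2) unfolding nowhere_dense_in_iff by meson
  then show "\<exists>Q. openin T Q \<and> Q \<noteq> {} \<and> Q \<subseteq> P \<and> Q \<inter> (S \<union> S') = {}"
    using Q by blast
qed

text \<open>The topological content of \<open>RB\<close>. A refinement of
  \<open>P \<inter> V\<close> that avoids \<open>V - A\<close> is an open subset of
  \<open>A\<close>, hence lies in the interior; if \<open>P\<close> misses \<open>V\<close>, then
  \<open>P\<close> itself serves.\<close>

lemma nowhere_dense_in_diff_interior:
  assumes V: "openin T V" and nd: "nowhere_dense_in T (V - A)"
  shows "nowhere_dense_in T (V - T interior_of A)"
  unfolding nowhere_dense_in_iff
proof (intro conjI allI impI)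
  show "V - T interior_of A \<subseteq> topspace T"
    using openin_subset[OF V] by blast
  fix P assume P: "openin T P" "P \<noteq> {}"
  show "\<exists>Q. openin T Q \<and> Q \<noteq> {} \<and> Q \<subseteq> P \<and> Q \<inter> (V - T interior_of A) = {}"
  proof (cases "P \<inter> V = {}")
    case True
    then show ?thesis using P by blast
  next
    case False
    moreover have "openin T (P \<inter> V)" using P V by blast
    ultimately obtain Q where Q: "openin T Q" "Q \<noteq> {}" "Q \<subseteq> P \<inter> V" "Q \<inter> (V - A) = {}"
      using nd unfolding nowhere_dense_in_iff by meson
    then have "Q \<subseteq> T interior_of A"
      by (intro interior_of_maximal) auto
    then show ?thesis using Q by blast
  qed
qed

text \<open>An open \<open>Q\<close> missing \<open>P\<close> meets \<open>U\<close> only inside the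
  interior of \<open>U - P\<close>, so \<open>Q\<close> itself avoids the set; otherwise
  \<open>Q \<inter> P\<close> does.\<close>

lemma nowhere_dense_in_boundary:
  assumes U: "openin T U" and P: "openin T P"
  shows "nowhere_dense_in T (U - (P \<union> T interior_of (U - P)))"
  unfolding nowhere_dense_in_iff
proof (intro conjI allI impI)
  show "U - (P \<union> T interior_of (U - P)) \<subseteq> topspace T"
    using openin_subset[OF U] by blast
  fix Q assume Q: "openin T Q" "Q \<noteq> {}"
  show "\<exists>Q'. openin T Q' \<and> Q' \<noteq> {} \<and> Q' \<subseteq> Q \<and> Q' \<inter> (U - (P \<union> T interior_of (U - P))) = {}"
  proof (cases "Q \<inter> P = {}")
    case True
    then have "Q \<inter> U \<subseteq> T interior_of (U - P)"
      using Q U by (intro interior_of_maximal) auto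
    then show ?thesis using Q by blast
  next
    case False
    then show ?thesis using Q P by (intro exI[of _ "Q \<inter> P"]) auto
  qed
qed

section \<open>Soundness\<close>

text \<open>Truth at a fixed scenario is itself a propositional valuation, so tautologies are true
  there.\<close>

lemma prop_eval_sat: "prop_eval (sat T v x U V) \<psi> \<longleftrightarrow> sat T v x U V \<psi>"
  by (induction \<psi>) auto

lemma sat_Know: "sat T v x U V (\<^bold>K \<phi>) \<longleftrightarrow> (\<forall>y\<in>U. sat T v y U V \<phi>)"
  by auto

text \<open>The defining equation of the \<open>K\<close>-clause loops as a rewrite rule for \<open>U\<close>.\<close>

declare sat.simps(4) [simp del]

text \<open>The modalities move only the point, so \<open>U\<close> and \<open>V\<close> stay fixed
  while \<open>x\<close> varies, as the necessitation rules require. The extra axioms are assumed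
  true for this pair only, so one induction serves both systems.\<close>

lemma EL_plus_sound:
  assumes "EL_plus A \<phi>" and U: "openin T U" and V: "openin T V" and VU: "V \<subseteq> U"
    and ax: "\<And>\<psi> x. \<psi> \<in> A \<Longrightarrow> x \<in> U \<Longrightarrow> sat T v x U V \<psi>"
  shows "x \<in> U \<Longrightarrow> sat T v x U V \<phi>"
  using assms(1)
proof (induction arbitrary: x)
  case (Taut \<phi>)
  then show ?case by (simp add: tautology_def flip: prop_eval_sat[of T v x U V \<phi>])
next
  case (MP \<phi> \<psi>)
  then show ?case by auto
next
  case (Nec_Box \<phi>)
  then have "{y \<in> U. sat T v y U V \<phi>} = U" by blast
  then show ?case using Nec_Box U by (simp add: interior_of_openin)
next
  case (K_Box \<phi> \<psi>)
  have "T interior_of {y \<in> U. sat T v y U V (\<phi> \<^bold>\<longrightarrow> \<psi>)} \<inter> T interior_of {y \<in> U. sat T v y U V \<phi>}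
      \<subseteq> T interior_of {y \<in> U. sat T v y U V \<psi>}"
    by (subst interior_of_Int[symmetric], rule interior_of_mono) auto
  then show ?case by auto
next
  case (T_Box \<phi>)
  then show ?case using interior_of_subset by fastforce
next
  case (Four_Box \<phi>)
  have "{y \<in> U. y \<in> T interior_of {y \<in> U. sat T v y U V \<phi>}} = T interior_of {y \<in> U. sat T v y U V \<phi>}"
    using interior_of_subset by fastforce
  then show ?case by simp
next
  case (KI \<phi>)
  have "{y \<in> U. sat T v y U V \<phi>} = U" if "sat T v x U V (\<^bold>K \<phi>)"
    using that by (auto simp: sat_Know)
  then show ?case using KI U by (auto simp: interior_of_openin)
next
  case (K_B \<phi> \<psi>)
  let ?I = "V - {y \<in> U. sat T v y U V (\<phi> \<^bold>\<longrightarrow> \<psi>)}" and ?P = "V - {y \<in> U. sat T v y U V \<phi>}"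
  let ?N = "nowhere_dense_in T"
  have "V - {y \<in> U. sat T v y U V \<psi>} \<subseteq> ?I \<union> ?P" by auto
  then have "?N (V - {y \<in> U. sat T v y U V \<psi>})" if "?N ?I" "?N ?P"
    by (rule nowhere_dense_in_subset[OF nowhere_dense_in_Un[OF that]])
  then show ?case unfolding sat.simps almost_subset_def by blast
next
  case (sPI \<phi>)
  then show ?case by (simp add: sat_Know)
next
  case (KB \<phi>)
  have "nowhere_dense_in T (V - {y \<in> U. sat T v y U V \<phi>})" if "sat T v x U V (\<^bold>K \<phi>)"
  proof -
    have "V - {y \<in> U. sat T v y U V \<phi>} = {}" using that VU by (auto simp: sat_Know)
    then show ?thesis by (simp only: nowhere_dense_in_empty)
  qed
  then show ?case by (simp add: almost_subset_def)
next
  case (RB \<phi>)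
  have "{y \<in> U. y \<in> T interior_of {y \<in> U. sat T v y U V \<phi>}} = T interior_of {y \<in> U. sat T v y U V \<phi>}"
    using interior_of_subset by fastforce
  then show ?case
    using nowhere_dense_in_diff_interior[OF V] by (simp add: almost_subset_def)
next
  case (Extra \<phi>)
  then show ?case using ax by blast
next
  case (K_K \<phi> \<psi>)
  show ?case by (simp add: sat_Know) metis
next
  case (T_K \<phi>)
  then show ?case by (simp add: sat_Know) metis
next
  case (Four_K \<phi>)
  show ?case by (simp add: sat_Know) metis
next
  case (Five_K \<phi>)
  show ?case by (simp add: sat_Know) metis
next
  case (Nec_K \<phi>)
  then show ?case by (simp add: sat_Know)
qed

text \<open>With \<open>P\<close> the open truth set of \<box>\<phi>, the disjunction fails in
  \<open>U\<close> exactly on the part of \<open>U\<close> outside \<open>P\<close> and the interior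
  of \<open>U - P\<close>, and \<open>V\<close> is contained in \<open>U\<close>.\<close>

lemma CB_sound:
  assumes U: "openin T U" and VU: "V \<subseteq> U" and "\<psi> \<in> CB"
  shows "sat T v x U V \<psi>"
proof -
  obtain \<phi> where \<psi>: "\<psi> = \<^bold>B (\<^bold>\<box> \<phi> \<^bold>\<or> \<^bold>\<box> (\<^bold>\<not> (\<^bold>\<box> \<phi>)))"
    using assms(3) by (auto simp: CB_def)
  define P where "P = T interior_of {y \<in> U. sat T v y U V \<phi>}"
  have "nowhere_dense_in T (U - (P \<union> T interior_of (U - P)))"
    using U by (intro nowhere_dense_in_boundary) (auto simp: P_def)
  moreover have "{y \<in> U. y \<notin> P} = U - P" by blast
  ultimately show ?thesis
    using VU unfolding \<psi> by (auto simp: almost_subset_def P_def[symmetric] intro: nowhere_dense_in_subset)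
qed

text \<open>If \<open>U - A\<close> is nowhere dense, then its interior, lying inside the interior
  of its closure, is empty; so \<open>x\<close> cannot be an interior point of the refutation set of
  \<phi>.\<close>

lemma wF_sound:
  assumes x: "x \<in> U" and U: "openin T U" and "\<psi> \<in> wF"
  shows "sat T v x U U \<psi>"
proof -
  obtain \<phi> where \<psi>: "\<psi> = \<^bold>B \<phi> \<^bold>\<longrightarrow> \<^bold>\<diamond> \<phi>"
    using assms(3) by (auto simp: wF_def)
  define A where "A = {y \<in> U. sat T v y U U \<phi>}"
  have eq: "{y \<in> U. \<not> sat T v y U U \<phi>} = U - A" by (auto simp: A_def)
  have "x \<notin> T interior_of (U - A)" if "nowhere_dense_in T (U - A)"
    using that interior_of_mono[OF closure_of_subset, of "U - A" T]
    by (auto simp: nowhere_dense_in_def)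
  then show ?thesis
    unfolding \<psi> by (simp add: almost_subset_def eq A_def[symmetric])
qed

section \<open>Soundness of the two systems\<close>

lemma EL_CB_sound:
  assumes "EL_CB \<phi>"
  shows "ae_valid TYPE('a) \<phi>"
  unfolding ae_valid_def ed_scenario_def
proof (intro allI impI, elim conjE)
  fix T :: "'a topology" and v x U V
  assume U: "openin T U" and V: "openin T V" and VU: "V \<subseteq> U" and x: "x \<in> U"
  show "sat T v x U V \<phi>"
    by (rule EL_plus_sound[OF assms[unfolded EL_CB_def] U V VU CB_sound[OF U VU] x])
qed

lemma SEL_sound:
  fixes \<phi> :: "'b fm"
  assumes "SEL \<phi>"
  shows "ae_valid_diag TYPE('a) \<phi>"
  unfolding ae_valid_diag_def ed_scenario_def
proof (intro allI impI, elim conjE)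
  fix T :: "'a topology" and v :: "'b \<Rightarrow> 'a set" and x U
  assume U: "openin T U" and x: "x \<in> U"
  have ax: "sat T v y U U \<psi>" if "\<psi> \<in> wF \<union> CB" "y \<in> U" for \<psi> y
    using that(1)
  proof
    assume "\<psi> \<in> wF"
    then show ?thesis by (rule wF_sound[OF that(2) U])
  next
    assume "\<psi> \<in> CB"
    then show ?thesis by (rule CB_sound[OF U order_refl])
  qed
  show "sat T v x U U \<phi>"
    by (rule EL_plus_sound[OF assms[unfolded SEL_def] U U order_refl ax x])
qed

section \<open>Maximal consistent sets\<close>

text \<open>Closed under modus ponens but not under necessitation, and possibly inconsistent;
  consistency is expressed below by omitting some formula.\<close>

definition theory_of :: "'p fm set \<Rightarrow> 'p fm set \<Rightarrow> bool" where
  "theory_of A S \<longleftrightarrow> (\<forall>\<phi>. EL_plus A \<phi> \<longrightarrow> \<phi> \<in> S) \<and> (\<forall>\<phi> \<psi>. \<phi> \<^bold>\<longrightarrow> \<psi> \<in> S \<longrightarrow> \<phi> \<in> S \<longrightarrow> \<psi> \<in> S)"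

definition mcs :: "'p fm set \<Rightarrow> 'p fm set \<Rightarrow> bool" where
  "mcs A S \<longleftrightarrow> theory_of A S \<and> (\<forall>\<phi>. \<^bold>\<not> \<phi> \<in> S \<longleftrightarrow> \<phi> \<notin> S)"

lemma theory_of_thm: "theory_of A S \<Longrightarrow> EL_plus A \<phi> \<Longrightarrow> \<phi> \<in> S"
  by (auto simp: theory_of_def)

lemma theory_of_MP: "theory_of A S \<Longrightarrow> \<phi> \<^bold>\<longrightarrow> \<psi> \<in> S \<Longrightarrow> \<phi> \<in> S \<Longrightarrow> \<psi> \<in> S"
  unfolding theory_of_def by blast

lemma theory_of_taut1:
  "theory_of A S \<Longrightarrow> \<phi> \<in> S \<Longrightarrow> tautology (\<phi> \<^bold>\<longrightarrow> \<psi>) \<Longrightarrow> \<psi> \<in> S"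
  by (rule theory_of_MP[OF _ theory_of_thm[OF _ EL_plus.Taut]])

lemma theory_of_taut2:
  "theory_of A S \<Longrightarrow> \<phi> \<in> S \<Longrightarrow> \<psi> \<in> S \<Longrightarrow> tautology (\<phi> \<^bold>\<longrightarrow> (\<psi> \<^bold>\<longrightarrow> \<eta>)) \<Longrightarrow> \<eta> \<in> S"
  by (rule theory_of_MP[OF _ theory_of_taut1])

text \<open>This set consists of the consequences of \<open>S\<close> together with \<eta>; defining
  it through implications takes the place of a deduction theorem.\<close>

lemma theory_of_adjoin:
  assumes "theory_of A S"
  shows "theory_of A {\<theta>. \<eta> \<^bold>\<longrightarrow> \<theta> \<in> S}"
proof -
  have "\<eta> \<^bold>\<longrightarrow> \<theta> \<in> S" if "EL_plus A \<theta>" for \<theta>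
    using theory_of_taut1[OF assms theory_of_thm[OF assms that]] by (simp add: tautology_def)
  moreover have "\<eta> \<^bold>\<longrightarrow> \<psi> \<in> S" if "\<eta> \<^bold>\<longrightarrow> (\<phi> \<^bold>\<longrightarrow> \<psi>) \<in> S" "\<eta> \<^bold>\<longrightarrow> \<phi> \<in> S" for \<phi> \<psi>
    using theory_of_taut2[OF assms that] by (simp add: tautology_def)
  ultimately show ?thesis
    unfolding theory_of_def by blast
qed

text \<open>Zorn's lemma gives a theory \<open>M\<close> maximal among those that extend
  \<open>S\<close> and omit \<psi>. Maximality relative to \<psi> already decides every
  formula.\<close>

lemma Lindenbaum:
  assumes S: "theory_of A S" and \<psi>: "\<psi> \<notin> S"
  shows "\<exists>M. mcs A M \<and> S \<subseteq> M \<and> \<psi> \<notin> M"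
proof -
  let ?C = "{M. theory_of A M \<and> S \<subseteq> M \<and> \<psi> \<notin> M}"
  have "\<exists>M\<in>?C. \<forall>X\<in>?C. M \<subseteq> X \<longrightarrow> X = M"
  proof (rule subset_Zorn_nonempty)
    show "?C \<noteq> {}" using assms by blast
  next
    fix \<C> assume ne: "\<C> \<noteq> {}" and ch: "subset.chain ?C \<C>"
    have sub: "\<C> \<subseteq> ?C" using ch by (simp add: subset.chain_def)
    have "\<theta> \<in> \<Union>\<C>" if hyp: "\<phi> \<^bold>\<longrightarrow> \<theta> \<in> \<Union>\<C>" "\<phi> \<in> \<Union>\<C>" for \<phi> \<theta>
    proof -
      obtain M N where MN: "M \<in> \<C>" "N \<in> \<C>" "\<phi> \<^bold>\<longrightarrow> \<theta> \<in> M" "\<phi> \<in> N" using hyp by blast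
      then consider "M \<subseteq> N" | "N \<subseteq> M" using subset_chain_def ch by metis
      then show ?thesis using MN sub theory_of_MP by cases blast+
    qed
    moreover have "\<phi> \<in> \<Union>\<C>" if "EL_plus A \<phi>" for \<phi>
      using that ne sub theory_of_thm by blast
    ultimately have "theory_of A (\<Union>\<C>)"
      unfolding theory_of_def by blast
    then show "\<Union>\<C> \<in> ?C" using ne sub by blast
  qed
  then obtain M where M: "theory_of A M" "S \<subseteq> M" "\<psi> \<notin> M"
    and max: "\<And>X. theory_of A X \<Longrightarrow> S \<subseteq> X \<Longrightarrow> \<psi> \<notin> X \<Longrightarrow> M \<subseteq> X \<Longrightarrow> X = M" by auto
  \<comment> \<open>Adjoining \<eta> to \<open>M\<close> gives a strictly larger theory, which by
    maximality must contain \<psi>.\<close>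
  have imp: "\<eta> \<^bold>\<longrightarrow> \<psi> \<in> M" if "\<eta> \<notin> M" for \<eta>
  proof (rule ccontr)
    let ?X = "{\<theta>. \<eta> \<^bold>\<longrightarrow> \<theta> \<in> M}"
    assume "\<eta> \<^bold>\<longrightarrow> \<psi> \<notin> M"
    moreover have "M \<subseteq> ?X"
      using theory_of_taut1[OF M(1)] by (auto simp: tautology_def)
    moreover have "\<eta> \<^bold>\<longrightarrow> \<eta> \<in> M"
      by (intro theory_of_thm[OF M(1)] EL_plus.Taut) (simp add: tautology_def)
    ultimately show False
      using max[of ?X] theory_of_adjoin[OF M(1)] M(2) that by blast
  qed
  have "\<^bold>\<not> \<eta> \<in> M \<longleftrightarrow> \<eta> \<notin> M" for \<eta>
  proof
    assume "\<^bold>\<not> \<eta> \<in> M"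
    then show "\<eta> \<notin> M"
      using theory_of_taut2[OF M(1), of \<eta> "\<^bold>\<not> \<eta>" \<psi>] M(3) by (auto simp: tautology_def)
  next
    assume "\<eta> \<notin> M"
    \<comment> \<open>If the negation of \<eta> were missing too, \<open>imp\<close> would apply to
      both formulas, and case distinction would put \<psi> into \<open>M\<close>.\<close>
    then show "\<^bold>\<not> \<eta> \<in> M"
      using theory_of_taut2[OF M(1) imp imp, of \<eta> "\<^bold>\<not> \<eta>" \<psi>] M(3) by (auto simp: tautology_def)
  qed
  then show ?thesis using M unfolding mcs_def by blast
qed

lemma mcs_theory: "mcs A S \<Longrightarrow> theory_of A S"
  by (simp add: mcs_def)

lemma mcs_Neg: "mcs A S \<Longrightarrow> \<^bold>\<not> \<phi> \<in> S \<longleftrightarrow> \<phi> \<notin> S"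
  by (simp add: mcs_def)

lemma mcs_And:
  assumes "mcs A S"
  shows "\<phi> \<^bold>\<and> \<psi> \<in> S \<longleftrightarrow> \<phi> \<in> S \<and> \<psi> \<in> S"
proof -
  note t = mcs_theory[OF assms]
  have "\<phi> \<in> S" "\<psi> \<in> S" if "\<phi> \<^bold>\<and> \<psi> \<in> S"
    by (rule theory_of_taut1[OF t that]; simp add: tautology_def)+
  moreover have "\<phi> \<^bold>\<and> \<psi> \<in> S" if "\<phi> \<in> S" "\<psi> \<in> S"
    by (rule theory_of_taut2[OF t that]) (simp add: tautology_def)
  ultimately show ?thesis by blast
qed

lemma mcs_imp: "mcs A S \<Longrightarrow> EL_plus A (\<phi> \<^bold>\<longrightarrow> \<psi>) \<Longrightarrow> \<phi> \<in> S \<Longrightarrow> \<psi> \<in> S"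
  by (rule theory_of_MP[OF mcs_theory theory_of_thm[OF mcs_theory]])

section \<open>Accessibility\<close>

text \<open>Treats the three modalities uniformly, so that the existence of accessible points is
  proved only once.\<close>

definition normal_op :: "'p fm set \<Rightarrow> ('p fm \<Rightarrow> 'p fm) \<Rightarrow> bool" where
  "normal_op A M \<longleftrightarrow> (\<forall>\<phi> \<psi>. EL_plus A (M (\<phi> \<^bold>\<longrightarrow> \<psi>) \<^bold>\<longrightarrow> (M \<phi> \<^bold>\<longrightarrow> M \<psi>)))
     \<and> (\<forall>\<phi>. EL_plus A \<phi> \<longrightarrow> EL_plus A (M \<phi>))"

definition acc :: "('p fm \<Rightarrow> 'p fm) \<Rightarrow> 'p fm set \<Rightarrow> 'p fm set \<Rightarrow> bool" where
  "acc M \<Gamma> \<Delta> \<longleftrightarrow> (\<forall>\<eta>. M \<eta> \<in> \<Gamma> \<longrightarrow> \<eta> \<in> \<Delta>)"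

lemma accD: "acc M \<Gamma> \<Delta> \<Longrightarrow> M \<eta> \<in> \<Gamma> \<Longrightarrow> \<eta> \<in> \<Delta>"
  by (simp add: acc_def)

lemma normal_op_Know: "normal_op A Know"
  by (simp add: normal_op_def EL_plus.K_K EL_plus.Nec_K)

lemma normal_op_Box: "normal_op A Box"
  by (simp add: normal_op_def EL_plus.K_Box EL_plus.Nec_Box)

text \<open>Necessitation for belief is not a primitive rule; it comes from \<open>Nec_K\<close>
  followed by \<open>KB\<close>.\<close>

lemma normal_op_Bel: "normal_op A Bel"
  unfolding normal_op_def using EL_plus.K_B EL_plus.MP[OF EL_plus.KB EL_plus.Nec_K] by blast

lemma theory_of_preimage:
  assumes "theory_of A \<Gamma>" "normal_op A M"
  shows "theory_of A {\<eta>. M \<eta> \<in> \<Gamma>}"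
  unfolding theory_of_def
proof (intro conjI allI impI CollectI; (elim CollectE)?)
  fix \<phi> assume "EL_plus A \<phi>"
  then show "M \<phi> \<in> \<Gamma>"
    using assms(2) theory_of_thm[OF assms(1)] by (simp add: normal_op_def)
next
  fix \<phi> \<psi> assume "M (\<phi> \<^bold>\<longrightarrow> \<psi>) \<in> \<Gamma>" "M \<phi> \<in> \<Gamma>"
  moreover have "M (\<phi> \<^bold>\<longrightarrow> \<psi>) \<^bold>\<longrightarrow> (M \<phi> \<^bold>\<longrightarrow> M \<psi>) \<in> \<Gamma>"
    using assms(2) theory_of_thm[OF assms(1)] by (simp add: normal_op_def)
  ultimately show "M \<psi> \<in> \<Gamma>"
    using theory_of_MP[OF assms(1)] by metis
qed

text \<open>If \<open>M \<eta>\<close> is not in \<Gamma>, the formulas whose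
  \<open>M\<close>-prefixed form is in \<Gamma> form a theory omitting \<eta>, and a Lindenbaum
  extension of it is an accessible point omitting \<eta>.\<close>

lemma mem_op_iff:
  assumes "mcs A \<Gamma>" "normal_op A M"
  shows "M \<eta> \<in> \<Gamma> \<longleftrightarrow> (\<forall>\<Delta>. mcs A \<Delta> \<longrightarrow> acc M \<Gamma> \<Delta> \<longrightarrow> \<eta> \<in> \<Delta>)"
  using Lindenbaum[OF theory_of_preimage[OF mcs_theory[OF assms(1)] assms(2)], of \<eta>]
  unfolding acc_def by blast

section \<open>Frame properties of the accessibility relations\<close>

lemma acc_Box_refl: "mcs A \<Gamma> \<Longrightarrow> acc Box \<Gamma> \<Gamma>"
  unfolding acc_def by (intro allI impI) (rule mcs_imp[OF _ EL_plus.T_Box])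

lemma acc_Box_trans: "mcs A \<Gamma> \<Longrightarrow> acc Box \<Gamma> \<Delta> \<Longrightarrow> acc Box \<Delta> \<Theta> \<Longrightarrow> acc Box \<Gamma> \<Theta>"
  by (simp add: acc_def mcs_imp[OF _ EL_plus.Four_Box])

lemma acc_Know_refl: "mcs A \<Gamma> \<Longrightarrow> acc Know \<Gamma> \<Gamma>"
  unfolding acc_def by (intro allI impI) (rule mcs_imp[OF _ EL_plus.T_K])

text \<open>Axiom 4 carries knowledge forward and axiom 5 carries its absence forward.\<close>

lemma acc_Know_Know_iff:
  assumes "mcs A \<Gamma>" "mcs A \<Delta>" "acc Know \<Gamma> \<Delta>"
  shows "\<^bold>K \<eta> \<in> \<Delta> \<longleftrightarrow> \<^bold>K \<eta> \<in> \<Gamma>"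
proof
  assume "\<^bold>K \<eta> \<in> \<Gamma>"
  then show "\<^bold>K \<eta> \<in> \<Delta>"
    using mcs_imp[OF assms(1) EL_plus.Four_K] accD[OF assms(3)] by blast
next
  assume "\<^bold>K \<eta> \<in> \<Delta>"
  then have "\<^bold>\<not> (\<^bold>K \<eta>) \<notin> \<Delta>"
    using mcs_Neg[OF assms(2)] by blast
  then have "\<^bold>\<not> (\<^bold>K \<eta>) \<notin> \<Gamma>"
    using mcs_imp[OF assms(1) EL_plus.Five_K] accD[OF assms(3)] by blast
  then show "\<^bold>K \<eta> \<in> \<Gamma>"
    using mcs_Neg[OF assms(1)] by blast
qed

text \<open>By \<open>sPI\<close> and \<open>T_K\<close>, believing \<eta> amounts to knowing that
  it is believed, so beliefs are as constant as knowledge.\<close>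

lemma acc_Know_Bel_iff:
  assumes "mcs A \<Gamma>" "mcs A \<Delta>" "acc Know \<Gamma> \<Delta>"
  shows "\<^bold>B \<eta> \<in> \<Delta> \<longleftrightarrow> \<^bold>B \<eta> \<in> \<Gamma>"
  using mcs_imp[OF assms(1) EL_plus.sPI] mcs_imp[OF assms(2) EL_plus.sPI]
    mcs_imp[OF assms(1) EL_plus.T_K] mcs_imp[OF assms(2) EL_plus.T_K]
    acc_Know_Know_iff[OF assms] by blast

text \<open>By \<open>KI\<close>, box steps never leave the \<open>K\<close>-cluster.\<close>

lemma acc_Know_Box:
  assumes "mcs A \<Gamma>" "mcs A \<Delta>" "acc Know \<Gamma> \<Delta>" "acc Box \<Delta> \<Theta>"
  shows "acc Know \<Gamma> \<Theta>"
  using acc_Know_Know_iff[OF assms(1-3)] mcs_imp[OF assms(2) EL_plus.KI] assms(4)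
  unfolding acc_def by blast

lemma acc_Bel_Know: "mcs A \<Gamma> \<Longrightarrow> acc Bel \<Gamma> \<Delta> \<Longrightarrow> acc Know \<Gamma> \<Delta>"
  by (simp add: acc_def mcs_imp[OF _ EL_plus.KB])

lemma acc_Bel_Box: "mcs A \<Gamma> \<Longrightarrow> acc Bel \<Gamma> \<Delta> \<Longrightarrow> acc Box \<Delta> \<Theta> \<Longrightarrow> acc Bel \<Gamma> \<Theta>"
  by (simp add: acc_def mcs_imp[OF _ EL_plus.RB])

text \<open>The \<open>CB\<close> instance for \<eta> is believed, so \<Delta> contains one
  disjunct. The second is excluded because \<Delta> sees \<Theta>, which contains \<box>\<eta>;
  hence \<box>\<eta> is in \<Delta>.\<close>

lemma acc_Box_sym:
  assumes CB: "CB \<subseteq> A" and m: "mcs A \<Gamma>" "mcs A \<Delta>" "mcs A \<Theta>"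
    and B: "acc Bel \<Gamma> \<Delta>" and R: "acc Box \<Delta> \<Theta>"
  shows "acc Box \<Theta> \<Delta>"
  unfolding acc_def
proof (intro allI impI)
  fix \<eta> assume \<eta>: "\<^bold>\<box> \<eta> \<in> \<Theta>"
  have "EL_plus A (\<^bold>B (\<^bold>\<box> \<eta> \<^bold>\<or> \<^bold>\<box> (\<^bold>\<not> (\<^bold>\<box> \<eta>))))"
    using CB by (intro EL_plus.Extra) (auto simp: CB_def)
  then have "\<^bold>\<box> \<eta> \<^bold>\<or> \<^bold>\<box> (\<^bold>\<not> (\<^bold>\<box> \<eta>)) \<in> \<Delta>"
    using theory_of_thm mcs_theory m(1) B accD by blast
  moreover have "\<^bold>\<box> (\<^bold>\<not> (\<^bold>\<box> \<eta>)) \<notin> \<Delta>"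
    using accD[OF R] mcs_Neg[OF m(3)] \<eta> by blast
  ultimately have "\<^bold>\<box> \<eta> \<in> \<Delta>"
    by (simp add: mcs_Neg[OF m(2)] mcs_And[OF m(2)])
  then show "\<eta> \<in> \<Delta>"
    using mcs_imp[OF m(2) EL_plus.T_Box] by blast
qed

text \<open>The required point extends the boxed formulas of \<Delta> together with the beliefs of
  \<Gamma>. Were these jointly inconsistent, \<Delta> would box the negation of some belief, against
  \<open>wF\<close>.\<close>

lemma acc_Bel_dense:
  assumes wF: "wF \<subseteq> A" and m: "mcs A \<Gamma>" "mcs A \<Delta>" and K: "acc Know \<Gamma> \<Delta>"
  shows "\<exists>\<Theta>. mcs A \<Theta> \<and> acc Box \<Delta> \<Theta> \<and> acc Bel \<Gamma> \<Theta>"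
proof -
  define N where "N = {\<eta>. \<^bold>\<box> \<eta> \<in> \<Delta>}"
  define L where "L = {\<eta>. \<^bold>B \<eta> \<in> \<Gamma>}"
  have N: "theory_of A N" and L: "theory_of A L"
    unfolding N_def L_def
    using theory_of_preimage mcs_theory m normal_op_Box normal_op_Bel by blast+
  \<comment> \<open>The theory generated by \<open>N\<close> and \<open>L\<close>. One \<beta>
    suffices because \<open>L\<close> is closed under conjunction.\<close>
  define S where "S = {\<theta>. \<exists>\<beta>\<in>L. \<beta> \<^bold>\<longrightarrow> \<theta> \<in> N}"
  have taut: "\<phi> \<in> L" if "tautology \<phi>" for \<phi>
    using that theory_of_thm[OF L] EL_plus.Taut by blast
  have NS: "N \<subseteq> S"
  proof
    fix \<theta> assume "\<theta> \<in> N"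
    \<comment> \<open>An arbitrary tautology, used as the belief from which \<theta>
      follows.\<close>
    let ?t = "Atom undefined \<^bold>\<longrightarrow> Atom undefined"
    have "?t \<^bold>\<longrightarrow> \<theta> \<in> N"
      using theory_of_taut1[OF N \<open>\<theta> \<in> N\<close>] by (simp add: tautology_def)
    moreover have "?t \<in> L" by (rule taut) (simp add: tautology_def)
    ultimately show "\<theta> \<in> S" unfolding S_def by blast
  qed
  have LS: "L \<subseteq> S"
  proof
    fix \<theta> assume "\<theta> \<in> L"
    moreover have "\<theta> \<^bold>\<longrightarrow> \<theta> \<in> N"
      by (intro theory_of_thm[OF N] EL_plus.Taut) (simp add: tautology_def)
    ultimately show "\<theta> \<in> S" unfolding S_def by blast
  qed
  have "\<psi> \<in> S" if hyp: "\<phi> \<^bold>\<longrightarrow> \<psi> \<in> S" "\<phi> \<in> S" for \<phi> \<psi>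
  proof -
    obtain \<beta> \<gamma> where bg: "\<beta> \<in> L" "\<gamma> \<in> L" "\<beta> \<^bold>\<longrightarrow> (\<phi> \<^bold>\<longrightarrow> \<psi>) \<in> N" "\<gamma> \<^bold>\<longrightarrow> \<phi> \<in> N"
      using hyp unfolding S_def by blast
    have "\<beta> \<^bold>\<and> \<gamma> \<in> L"
      using theory_of_taut2[OF L bg(1,2)] by (simp add: tautology_def)
    moreover have "\<beta> \<^bold>\<and> \<gamma> \<^bold>\<longrightarrow> \<psi> \<in> N"
      using theory_of_taut2[OF N bg(3,4)] by (simp add: tautology_def)
    ultimately show ?thesis unfolding S_def by blast
  qed
  then have S: "theory_of A S"
    using NS theory_of_thm[OF N] unfolding theory_of_def by blast
  \<comment> \<open>Stands in for falsum; omitting it expresses consistency of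
    \<open>S\<close>.\<close>
  let ?f = "Atom undefined \<^bold>\<and> \<^bold>\<not> Atom undefined :: 'a fm"
  have "?f \<notin> S"
  proof
    assume "?f \<in> S"
    then obtain \<beta> where \<beta>: "\<beta> \<in> L" "\<beta> \<^bold>\<longrightarrow> ?f \<in> N"
      unfolding S_def by blast
    have "\<^bold>\<not> \<beta> \<in> N"
      using theory_of_taut1[OF N \<beta>(2)] by (simp add: tautology_def)
    moreover have "EL_plus A (\<^bold>B \<beta> \<^bold>\<longrightarrow> \<^bold>\<diamond> \<beta>)"
      using wF by (intro EL_plus.Extra) (auto simp: wF_def)
    then have "\<^bold>\<diamond> \<beta> \<in> \<Delta>"
      using mcs_imp[OF m(2)] \<beta>(1) acc_Know_Bel_iff[OF m K] by (simp add: L_def)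
    ultimately show False
      using mcs_Neg[OF m(2)] by (simp add: N_def)
  qed
  from Lindenbaum[OF S this] show ?thesis
    using NS LS unfolding N_def L_def acc_def by blast
qed

section \<open>The canonical model\<close>

definition cluster :: "'p fm set \<Rightarrow> 'p fm set \<Rightarrow> 'p fm set set" where
  "cluster A \<Gamma> = {\<Delta>. mcs A \<Delta> \<and> acc Know \<Gamma> \<Delta>}"

definition believed :: "'p fm set \<Rightarrow> 'p fm set \<Rightarrow> 'p fm set set" where
  "believed A \<Gamma> = {\<Delta>. mcs A \<Delta> \<and> acc Bel \<Gamma> \<Delta>}"

definition canon_top :: "'p fm set \<Rightarrow> 'p fm set \<Rightarrow> 'p fm set topology" where
  "canon_top A \<Gamma> = topology (\<lambda>S. S \<subseteq> cluster A \<Gamma> \<and>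
     (\<forall>\<Delta>\<in>S. \<forall>\<Theta>\<in>cluster A \<Gamma>. acc Box \<Delta> \<Theta> \<longrightarrow> \<Theta> \<in> S))"

definition canon_val :: "'p fm set \<Rightarrow> 'p fm set \<Rightarrow> 'p \<Rightarrow> 'p fm set set" where
  "canon_val A \<Gamma> p = {\<Delta> \<in> cluster A \<Gamma>. Atom p \<in> \<Delta>}"

text \<open>Up-sets are closed under arbitrary unions and binary intersections, so the predicate
  given to \<open>topology\<close> really is one.\<close>

lemma openin_canon_top:
  "openin (canon_top A \<Gamma>) S \<longleftrightarrow> S \<subseteq> cluster A \<Gamma> \<and>
     (\<forall>\<Delta>\<in>S. \<forall>\<Theta>\<in>cluster A \<Gamma>. acc Box \<Delta> \<Theta> \<longrightarrow> \<Theta> \<in> S)"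
proof -
  define P where "P S \<longleftrightarrow> S \<subseteq> cluster A \<Gamma> \<and>
    (\<forall>\<Delta>\<in>S. \<forall>\<Theta>\<in>cluster A \<Gamma>. acc Box \<Delta> \<Theta> \<longrightarrow> \<Theta> \<in> S)" for S
  have "P (S \<inter> S')" if "P S" "P S'" for S S'
    using that unfolding P_def by blast
  moreover have "P (\<Union>\<K>)" if "\<forall>S\<in>\<K>. P S" for \<K>
    using that unfolding P_def by fast
  ultimately have "istopology P"
    by (simp add: istopology_def)
  then show ?thesis
    unfolding canon_top_def P_def[symmetric] by (simp only: topology_inverse' flip: P_def)
qed

lemma topspace_canon_top [simp]: "topspace (canon_top A \<Gamma>) = cluster A \<Gamma>"
  unfolding topspace_def by (auto simp: openin_canon_top)

lemma openin_cone:
  "openin (canon_top A \<Gamma>) {\<Theta> \<in> cluster A \<Gamma>. acc Box \<Delta> \<Theta>}" if "\<Delta> \<in> cluster A \<Gamma>"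
  using that acc_Box_trans unfolding openin_canon_top cluster_def by blast

text \<open>The cone above \<Delta> is its least open neighbourhood, so interior becomes the Kripke
  box.\<close>

lemma interior_canon_top:
  assumes "\<Delta> \<in> cluster A \<Gamma>"
  shows "\<Delta> \<in> canon_top A \<Gamma> interior_of S \<longleftrightarrow> (\<forall>\<Theta>\<in>cluster A \<Gamma>. acc Box \<Delta> \<Theta> \<longrightarrow> \<Theta> \<in> S)"
proof
  assume "\<Delta> \<in> canon_top A \<Gamma> interior_of S"
  then show "\<forall>\<Theta>\<in>cluster A \<Gamma>. acc Box \<Delta> \<Theta> \<longrightarrow> \<Theta> \<in> S"
    unfolding interior_of_def openin_canon_top by blast
next
  assume "\<forall>\<Theta>\<in>cluster A \<Gamma>. acc Box \<Delta> \<Theta> \<longrightarrow> \<Theta> \<in> S"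
  then have "{\<Theta> \<in> cluster A \<Gamma>. acc Box \<Delta> \<Theta>} \<subseteq> S" by blast
  moreover have "\<Delta> \<in> {\<Theta> \<in> cluster A \<Gamma>. acc Box \<Delta> \<Theta>}"
    using assms acc_Box_refl unfolding cluster_def by blast
  ultimately show "\<Delta> \<in> canon_top A \<Gamma> interior_of S"
    using openin_cone[OF assms] unfolding interior_of_def by blast
qed

lemma openin_believed:
  assumes "mcs A \<Gamma>"
  shows "openin (canon_top A \<Gamma>) (believed A \<Gamma>)"
  using assms acc_Bel_Know acc_Bel_Box
  unfolding openin_canon_top cluster_def believed_def by blast

text \<open>By symmetry every point of the cone sees \<Delta> back, so the cone has no nonempty open
  subset without \<Delta>.\<close>

lemma believed_cone_subset:
  assumes "CB \<subseteq> A" "mcs A \<Gamma>" and \<Delta>: "\<Delta> \<in> believed A \<Gamma>"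
    and Q: "openin (canon_top A \<Gamma>) Q" "Q \<noteq> {}" "Q \<subseteq> {\<Theta> \<in> cluster A \<Gamma>. acc Box \<Delta> \<Theta>}"
  shows "\<Delta> \<in> Q"
proof -
  obtain \<Theta> where \<Theta>: "\<Theta> \<in> Q" "mcs A \<Theta>" "acc Box \<Delta> \<Theta>"
    using Q(2,3) unfolding cluster_def by blast
  have "acc Box \<Theta> \<Delta>"
    using acc_Box_sym assms(1,2) \<Delta> \<Theta> unfolding believed_def by blast
  then show ?thesis
    using Q(1) \<Theta>(1) \<Delta> acc_Bel_Know[OF assms(2)]
    unfolding openin_canon_top cluster_def believed_def by blast
qed

text \<open>Refining the cone of \<Delta> to avoid \<open>V - S\<close> cannot lose \<Delta>, which
  lies in \<open>V\<close>; hence \<Delta> lies in \<open>S\<close>.\<close>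

lemma believed_subset_of_almost:
  assumes "CB \<subseteq> A" "mcs A \<Gamma>" "believed A \<Gamma> \<subseteq> V" "nowhere_dense_in (canon_top A \<Gamma>) (V - S)"
  shows "believed A \<Gamma> \<subseteq> S"
proof
  fix \<Delta> assume \<Delta>: "\<Delta> \<in> believed A \<Gamma>"
  then have c: "\<Delta> \<in> cluster A \<Gamma>" and r: "acc Box \<Delta> \<Delta>"
    using acc_Bel_Know[OF assms(2)] acc_Box_refl unfolding believed_def cluster_def by blast+
  let ?P = "{\<Theta> \<in> cluster A \<Gamma>. acc Box \<Delta> \<Theta>}"
  have "?P \<noteq> {}" using c r by blast
  then obtain Q where Q: "openin (canon_top A \<Gamma>) Q" "Q \<noteq> {}" "Q \<subseteq> ?P" "Q \<inter> (V - S) = {}"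
    using assms(4) openin_cone[OF c] unfolding nowhere_dense_in_iff by meson
  have "\<Delta> \<in> Q"
    by (rule believed_cone_subset[OF assms(1,2) \<Delta> Q(1-3)])
  then show "\<Delta> \<in> S"
    using Q(4) assms(3) \<Delta> by blast
qed

text \<open>By \<open>acc_Bel_dense\<close> the open set \<open>believed A \<Gamma>\<close> meets
  every nonempty open set, so intersecting with it gives the refinement.\<close>

lemma nowhere_dense_compl_believed:
  assumes "wF \<subseteq> A" "mcs A \<Gamma>"
  shows "nowhere_dense_in (canon_top A \<Gamma>) (cluster A \<Gamma> - believed A \<Gamma>)"
  unfolding nowhere_dense_in_iff
proof (intro conjI allI impI)
  fix P assume P: "openin (canon_top A \<Gamma>) P" "P \<noteq> {}"
  then obtain \<Delta> where \<Delta>: "\<Delta> \<in> P" "mcs A \<Delta>" "acc Know \<Gamma> \<Delta>"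
    unfolding openin_canon_top cluster_def by blast
  then obtain \<Theta> where \<Theta>: "mcs A \<Theta>" "acc Box \<Delta> \<Theta>" "acc Bel \<Gamma> \<Theta>"
    using acc_Bel_dense[OF assms] by blast
  then have "\<Theta> \<in> P \<inter> believed A \<Gamma>"
    using P(1) \<Delta> acc_Bel_Know[OF assms(2)]
    unfolding openin_canon_top cluster_def believed_def by blast
  moreover have "openin (canon_top A \<Gamma>) (P \<inter> believed A \<Gamma>)"
    using P(1) openin_believed[OF assms(2)] by blast
  ultimately show "\<exists>Q. openin (canon_top A \<Gamma>) Q \<and> Q \<noteq> {} \<and> Q \<subseteq> P \<and>
      Q \<inter> (cluster A \<Gamma> - believed A \<Gamma>) = {}"
    by (intro exI[of _ "P \<inter> believed A \<Gamma>"]) blast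
qed auto

text \<open>\<open>V\<close> may exceed the believed set by a nowhere dense set, which covers both
  choices of \<open>V\<close> made for completeness.\<close>

lemma truth_lemma:
  assumes CB: "CB \<subseteq> A" and m: "mcs A \<Gamma>"
    and V: "believed A \<Gamma> \<subseteq> V" "nowhere_dense_in (canon_top A \<Gamma>) (V - believed A \<Gamma>)"
  shows "\<Delta> \<in> cluster A \<Gamma> \<Longrightarrow>
    sat (canon_top A \<Gamma>) (canon_val A \<Gamma>) \<Delta> (cluster A \<Gamma>) V \<phi> \<longleftrightarrow> \<phi> \<in> \<Delta>"
proof (induction \<phi> arbitrary: \<Delta>)
  case (Atom p)
  then show ?case by (simp add: canon_val_def)
next
  case (Neg \<phi>)
  then show ?case using mcs_Neg unfolding cluster_def by fastforce
next
  case (And \<phi> \<psi>)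
  then show ?case using mcs_And unfolding cluster_def by fastforce
next
  case (Know \<phi>)
  have \<Delta>: "mcs A \<Delta>" "acc Know \<Gamma> \<Delta>"
    using Know.prems by (auto simp: cluster_def)
  have "sat (canon_top A \<Gamma>) (canon_val A \<Gamma>) \<Delta> (cluster A \<Gamma>) V (\<^bold>K \<phi>)
      \<longleftrightarrow> (\<forall>\<Theta>\<in>cluster A \<Gamma>. \<phi> \<in> \<Theta>)"
    using Know.IH by (auto simp: sat_Know)
  also have "\<dots> \<longleftrightarrow> \<^bold>K \<phi> \<in> \<Gamma>"
    using mem_op_iff[OF m normal_op_Know] by (auto simp: cluster_def)
  finally show ?case
    using acc_Know_Know_iff[OF m \<Delta>] by blast
next
  case (Box \<phi>)
  have \<Delta>: "mcs A \<Delta>" "acc Know \<Gamma> \<Delta>"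
    using Box.prems by (auto simp: cluster_def)
  have "sat (canon_top A \<Gamma>) (canon_val A \<Gamma>) \<Delta> (cluster A \<Gamma>) V (\<^bold>\<box> \<phi>)
      \<longleftrightarrow> (\<forall>\<Theta>\<in>cluster A \<Gamma>. acc Box \<Delta> \<Theta> \<longrightarrow> \<phi> \<in> \<Theta>)"
    using Box.IH by (auto simp: interior_canon_top[OF Box.prems])
  also have "\<dots> \<longleftrightarrow> \<^bold>\<box> \<phi> \<in> \<Delta>"
    using mem_op_iff[OF \<Delta>(1) normal_op_Box] acc_Know_Box[OF m \<Delta>]
    by (auto simp: cluster_def)
  finally show ?case .
next
  case (Bel \<phi>)
  have \<Delta>: "mcs A \<Delta>" "acc Know \<Gamma> \<Delta>"
    using Bel.prems by (auto simp: cluster_def)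
  let ?S = "{\<Theta> \<in> cluster A \<Gamma>. \<phi> \<in> \<Theta>}"
  have "{\<Theta> \<in> cluster A \<Gamma>. sat (canon_top A \<Gamma>) (canon_val A \<Gamma>) \<Theta> (cluster A \<Gamma>) V \<phi>} = ?S"
    using Bel.IH by blast
  then have "sat (canon_top A \<Gamma>) (canon_val A \<Gamma>) \<Delta> (cluster A \<Gamma>) V (\<^bold>B \<phi>)
      \<longleftrightarrow> nowhere_dense_in (canon_top A \<Gamma>) (V - ?S)"
    by (simp add: almost_subset_def)
  \<comment> \<open>Conversely, if \<open>?S\<close> contains the believed set, then
    \<open>V - ?S\<close> lies in the nowhere dense excess of \<open>V\<close>.\<close>
  also have "\<dots> \<longleftrightarrow> believed A \<Gamma> \<subseteq> ?S"
    using believed_subset_of_almost[OF CB m V(1)] nowhere_dense_in_subset[OF V(2)] by blast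
  also have "\<dots> \<longleftrightarrow> \<^bold>B \<phi> \<in> \<Gamma>"
    using mem_op_iff[OF m normal_op_Bel] acc_Bel_Know[OF m]
    by (auto simp: cluster_def believed_def)
  finally show ?case
    using acc_Know_Bel_iff[OF m \<Delta>] by blast
qed

text \<open>The set of theorems is a theory omitting \<phi>, so some maximal consistent \<Gamma>
  omits it too. \<open>V\<close> stays quantified so that each completeness proof can choose its
  own.\<close>

lemma canonical_countermodel:
  assumes "CB \<subseteq> A" "\<not> EL_plus A \<phi>"
  obtains \<Gamma> where "mcs A \<Gamma>" "top_subset_model (canon_top A \<Gamma>) (canon_val A \<Gamma>)"
    "\<Gamma> \<in> cluster A \<Gamma>" "openin (canon_top A \<Gamma>) (cluster A \<Gamma>)"
    "\<forall>V. believed A \<Gamma> \<subseteq> V \<longrightarrow> nowhere_dense_in (canon_top A \<Gamma>) (V - believed A \<Gamma>) \<longrightarrow>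
      \<not> sat (canon_top A \<Gamma>) (canon_val A \<Gamma>) \<Gamma> (cluster A \<Gamma>) V \<phi>"
proof -
  have "theory_of A {\<phi>. EL_plus A \<phi>}"
    using EL_plus.MP unfolding theory_of_def by blast
  then obtain \<Gamma> where \<Gamma>: "mcs A \<Gamma>" "\<phi> \<notin> \<Gamma>"
    using Lindenbaum assms(2) by blast
  have c: "\<Gamma> \<in> cluster A \<Gamma>"
    using \<Gamma>(1) acc_Know_refl by (auto simp: cluster_def)
  show thesis
  proof (rule that[OF \<Gamma>(1) _ c])
    show "top_subset_model (canon_top A \<Gamma>) (canon_val A \<Gamma>)"
      using c by (auto simp: top_subset_model_def canon_val_def)
    show "openin (canon_top A \<Gamma>) (cluster A \<Gamma>)"
      by (simp add: openin_canon_top)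
  qed (use truth_lemma[OF assms(1) \<Gamma>(1) _ _ c] \<Gamma>(2) in blast)
qed

section \<open>Completeness of the two systems\<close>

lemma EL_CB_complete:
  fixes \<phi> :: "'p fm"
  assumes "ae_valid TYPE('p fm set) \<phi>"
  shows "EL_CB \<phi>"
proof (rule ccontr)
  assume "\<not> EL_CB \<phi>"
  then have "\<not> EL_plus CB \<phi>" by (simp add: EL_CB_def)
  then obtain \<Gamma> where \<Gamma>: "mcs CB \<Gamma>" "top_subset_model (canon_top CB \<Gamma>) (canon_val CB \<Gamma>)"
    "\<Gamma> \<in> cluster CB \<Gamma>" "openin (canon_top CB \<Gamma>) (cluster CB \<Gamma>)"
    and ns: "\<forall>V. believed CB \<Gamma> \<subseteq> V \<longrightarrow> nowhere_dense_in (canon_top CB \<Gamma>) (V - believed CB \<Gamma>) \<longrightarrow>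
      \<not> sat (canon_top CB \<Gamma>) (canon_val CB \<Gamma>) \<Gamma> (cluster CB \<Gamma>) V \<phi>"
    by (rule canonical_countermodel[OF order_refl])
  \<comment> \<open>Here \<open>V\<close> is the believed set itself, with empty excess.\<close>
  have "\<not> sat (canon_top CB \<Gamma>) (canon_val CB \<Gamma>) \<Gamma> (cluster CB \<Gamma>) (believed CB \<Gamma>) \<phi>"
    by (rule ns[rule_format]) (simp_all add: nowhere_dense_in_empty)
  moreover have "ed_scenario (canon_top CB \<Gamma>) \<Gamma> (cluster CB \<Gamma>) (believed CB \<Gamma>)"
    using \<Gamma>(3,4) openin_believed[OF \<Gamma>(1)] openin_subset[OF openin_believed[OF \<Gamma>(1)]]
    by (simp add: ed_scenario_def)
  ultimately show False
    using assms[unfolded ae_valid_def, rule_format, OF \<Gamma>(2)] by blast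
qed

lemma SEL_complete:
  fixes \<phi> :: "'p fm"
  assumes "ae_valid_diag TYPE('p fm set) \<phi>"
  shows "SEL \<phi>"
proof (rule ccontr)
  let ?A = "wF \<union> CB :: 'p fm set"
  assume "\<not> SEL \<phi>"
  then have "\<not> EL_plus ?A \<phi>" by (simp add: SEL_def)
  then obtain \<Gamma> where \<Gamma>: "mcs ?A \<Gamma>" "top_subset_model (canon_top ?A \<Gamma>) (canon_val ?A \<Gamma>)"
    "\<Gamma> \<in> cluster ?A \<Gamma>" "openin (canon_top ?A \<Gamma>) (cluster ?A \<Gamma>)"
    and ns: "\<forall>V. believed ?A \<Gamma> \<subseteq> V \<longrightarrow> nowhere_dense_in (canon_top ?A \<Gamma>) (V - believed ?A \<Gamma>) \<longrightarrow>
      \<not> sat (canon_top ?A \<Gamma>) (canon_val ?A \<Gamma>) \<Gamma> (cluster ?A \<Gamma>) V \<phi>"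
    by (rule canonical_countermodel[OF Un_upper2])
  \<comment> \<open>Here \<open>V\<close> is the whole cluster, whose excess over the believed set
    is nowhere dense by \<open>wF\<close>.\<close>
  have "\<not> sat (canon_top ?A \<Gamma>) (canon_val ?A \<Gamma>) \<Gamma> (cluster ?A \<Gamma>) (cluster ?A \<Gamma>) \<phi>"
    using openin_subset[OF openin_believed[OF \<Gamma>(1)]] nowhere_dense_compl_believed[OF _ \<Gamma>(1)]
    by (intro ns[rule_format]) auto
  moreover have "ed_scenario (canon_top ?A \<Gamma>) \<Gamma> (cluster ?A \<Gamma>) (cluster ?A \<Gamma>)"
    using \<Gamma>(3,4) by (simp add: ed_scenario_def)
  ultimately show False
    using assms[unfolded ae_valid_diag_def, rule_format, OF \<Gamma>(2)] by blast
qed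

(* HOL cannot quantify over all types inside a formula. Soundness is therefore stated for an
   arbitrary point type 'a, and completeness from validity over the single type of sets of formulas;
   together they give the equivalence with validity in all models over all types. *)

theorem theorem10:
  fixes \<phi> :: "'p::countable fm"
  shows "((EL_CB \<phi> \<longrightarrow> ae_valid TYPE('a) \<phi>) \<and>
          (EL_CB \<phi> \<longleftrightarrow> ae_valid TYPE('p fm set) \<phi>)) \<and>
         ((SEL \<phi> \<longrightarrow> ae_valid_diag TYPE('a) \<phi>) \<and>
          (SEL \<phi> \<longleftrightarrow> ae_valid_diag TYPE('p fm set) \<phi>))"
  by (intro conjI impI iffI; erule EL_CB_sound EL_CB_complete SEL_sound SEL_complete)

end
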